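(* For any constant $\delta > 0$, any dynamic algorithm that maintains a $(2-\delta)$-approximate solution to the Euclidean bi-chromatic matching problem under either insertions of pairs of points only or deletions of pairs of points only must have $\Omega(n)$ amortized update time, where $n$ is the number of points.
   Context: Euclidean bi-chromatic matching: for finite sets $A$ (red) and $B$ (blue) in $\mathbb{R}^2$ with $|A|=|B|$, a matching is a bijection $\mu:A\to B$ with cost $c(\mu)=\sum_{a\in A}\|a-\mu(a)\|_2$; it is $\alpha$-approximate if $c(\mu)\le\alpha\,c(\mu^* )$ for a minimum-cost matching $\mu^*$. An update inserts (respectively deletes) a pair consisting of one red point of $A$ and one blue point of $B$. The dynamic algorithm maintains an explicit matching of the current point sets after every update, so the time of an update is at least the number of edges in which the maintained matching changes. *)

theory Defs
  imports "HOL-Analysis.Analysis"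
begin

type_synonym point = "real ^ 2"

text \<open>Red point set and blue point set. The two need not be disjoint.\<close>
type_synonym config = "point set \<times> point set"

definition num_points :: "config \<Rightarrow> nat" where
  "num_points C = card (fst C) + card (snd C)"

definition is_matching :: "config \<Rightarrow> (point \<Rightarrow> point) \<Rightarrow> bool" where
  "is_matching C \<mu> \<longleftrightarrow> bij_betw \<mu> (fst C) (snd C)"

definition cost :: "config \<Rightarrow> (point \<Rightarrow> point) \<Rightarrow> real" where
  "cost C \<mu> = (\<Sum>a\<in>fst C. norm (a - \<mu> a))"

definition is_min_cost_matching :: "config \<Rightarrow> (point \<Rightarrow> point) \<Rightarrow> bool" where
  "is_min_cost_matching C \<mu> \<longleftrightarrow>
     is_matching C \<mu> \<and> (\<forall>\<nu>. is_matching C \<nu> \<longrightarrow> cost C \<mu> \<le> cost C \<nu>)"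

definition is_approx_matching :: "real \<Rightarrow> config \<Rightarrow> (point \<Rightarrow> point) \<Rightarrow> bool" where
  "is_approx_matching \<alpha> C \<mu> \<longleftrightarrow>
     is_matching C \<mu> \<and> (\<exists>\<mu>'. is_min_cost_matching C \<mu>' \<and> cost C \<mu> \<le> \<alpha> * cost C \<mu>')"

text \<open>A matching is a function on all points; only its restriction to the red points matters.\<close>
definition edges :: "config \<Rightarrow> (point \<Rightarrow> point) \<Rightarrow> (point \<times> point) set" where
  "edges C \<mu> = (\<lambda>a. (a, \<mu> a)) ` fst C"

datatype update = Insert point point | Delete point point

fun legal_update :: "config \<Rightarrow> update \<Rightarrow> bool" where
  "legal_update (A, B) (Insert a b) \<longleftrightarrow> a \<notin> A \<and> b \<notin> B"
| "legal_update (A, B) (Delete a b) \<longleftrightarrow> a \<in> A \<and> b \<in> B"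

fun apply_update :: "config \<Rightarrow> update \<Rightarrow> config" where
  "apply_update (A, B) (Insert a b) = (insert a A, insert b B)"
| "apply_update (A, B) (Delete a b) = (A - {a}, B - {b})"

definition apply_updates :: "config \<Rightarrow> update list \<Rightarrow> config" where
  "apply_updates C us = foldl apply_update C us"

fun legal_updates :: "config \<Rightarrow> update list \<Rightarrow> bool" where
  "legal_updates C [] \<longleftrightarrow> True"
| "legal_updates C (u # us) \<longleftrightarrow> legal_update C u \<and> legal_updates (apply_update C u) us"

text \<open>
  A run is an initial configuration together with a legal sequence of updates.
  Insertion-only runs start from the empty configuration, deletion-only runs from an arbitrary
  one. Both sets are closed under taking prefixes of the update sequence.
\<close>
type_synonym run = "config \<times> update list"

definition insertion_runs :: "run set" where
  "insertion_runs = {(C, us). C = ({}, {}) \<and> legal_updates C us \<and>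
     (\<forall>u\<in>set us. \<exists>a b. u = Insert a b)}"

definition deletion_runs :: "run set" where
  "deletion_runs = {(C, us). finite (fst C) \<and> finite (snd C) \<and> card (fst C) = card (snd C) \<and>
     legal_updates C us \<and> (\<forall>u\<in>set us. \<exists>a b. u = Delete a b)}"

text \<open>
  A deterministic online algorithm. Its matching after some updates may depend on the initial
  configuration and on all the updates so far, but not on later ones.
  The value \<open>upd_time alg C us\<close> is the time spent on the last update of \<open>us\<close>;
  building the matching of the initial configuration is not charged.
\<close>
record dyn_alg =
  alg_matching :: "config \<Rightarrow> update list \<Rightarrow> point \<Rightarrow> point"
  upd_time :: "config \<Rightarrow> update list \<Rightarrow> real"

text \<open>Number of edges that enter or leave the maintained matching when \<open>u\<close> follows \<open>us\<close>.\<close>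
definition num_changes :: "dyn_alg \<Rightarrow> config \<Rightarrow> update list \<Rightarrow> update \<Rightarrow> nat" where
  "num_changes alg C us u =
     (let M = edges (apply_updates C us) (alg_matching alg C us);
          M' = edges (apply_updates C (us @ [u])) (alg_matching alg C (us @ [u]))
      in card ((M - M') \<union> (M' - M)))"

definition maintains_approx :: "run set \<Rightarrow> real \<Rightarrow> dyn_alg \<Rightarrow> bool" where
  "maintains_approx R \<alpha> alg \<longleftrightarrow>
     (\<forall>(C, us)\<in>R. is_approx_matching \<alpha> (apply_updates C us) (alg_matching alg C us))"

definition explicit_updates :: "run set \<Rightarrow> dyn_alg \<Rightarrow> bool" where
  "explicit_updates R alg \<longleftrightarrow>
     (\<forall>C us u. (C, us @ [u]) \<in> R \<longrightarrow> real (num_changes alg C us u) \<le> upd_time alg C (us @ [u]))"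

definition dynamic_matching_algorithm :: "run set \<Rightarrow> real \<Rightarrow> dyn_alg \<Rightarrow> bool" where
  "dynamic_matching_algorithm R \<alpha> alg \<longleftrightarrow> maintains_approx R \<alpha> alg \<and> explicit_updates R alg"

definition total_time :: "dyn_alg \<Rightarrow> config \<Rightarrow> update list \<Rightarrow> real" where
  "total_time alg C us = (\<Sum>i<length us. upd_time alg C (take (Suc i) us))"

text \<open>
  The amortized update time on inputs with \<open>n\<close> points averages over complete runs: from the empty
  configuration up to \<open>n\<close> points, or from \<open>n\<close> points down to the empty configuration.
  Allowing deletion runs to stop early would turn the average into the cost of one update.
  There are no such runs for odd \<open>n\<close>.
\<close>
definition complete_insertion_runs :: "nat \<Rightarrow> run set" where
  "complete_insertion_runs n = {(C, us)\<in>insertion_runs. num_points (apply_updates C us) = n}"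

definition complete_deletion_runs :: "nat \<Rightarrow> run set" where
  "complete_deletion_runs n =
     {(C, us)\<in>deletion_runs. num_points C = n \<and> apply_updates C us = ({}, {})}"

definition amortized_update_time :: "run set \<Rightarrow> dyn_alg \<Rightarrow> ereal" where
  "amortized_update_time R alg =
     (SUP (C, us)\<in>R. ereal (total_time alg C us / real (length us)))"

end

theory Submission
  imports Defs
begin

text \<open>
  Put points on the integers of a line, coloured by parity, and let the interval grow (or shrink)
  by one integer at each end. For a gap between consecutive integers, the parity of the number
  of matching edges across it is determined by the number of points to its left, hence it flips at
  every update. So if \<open>s\<close> edges across the gap survive an update, then the matchings before
  and after together have at least \<open>2 * s + 1\<close> edges across it. Summing over the \<open>2 * k - 1\<close>
  gaps of \<open>2 * k\<close> points, the two costs add up to at least \<open>2 * S + 2 * k - 1\<close> if \<open>S\<close>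
  edges survive altogether. As matching neighbours costs only \<open>k\<close>, an approximation factor
  \<open>2 - \<delta>\<close> leaves at most about \<open>(1 - \<delta>) * k\<close> surviving edges.
\<close>

section \<open>Alternating configurations on a line and their optimum\<close>

definition pt :: "int \<Rightarrow> point" where
  "pt j = axis 1 (of_int j)"

definition conf :: "nat \<Rightarrow> config" where
  "conf k = (pt ` {j\<in>{-int k..<int k}. even j}, pt ` {j\<in>{-int k..<int k}. odd j})"

text \<open>The new end points \<open>k\<close> and \<open>- int k - 1\<close> have opposite
  parities, so each stage adds exactly one point per colour; the parity of \<open>k\<close> decides
  which end is red.\<close>

definition red :: "nat \<Rightarrow> int" where
  "red k = (if even k then int k else - int k - 1)"

definition blue :: "nat \<Rightarrow> int" where
  "blue k = (if even k then - int k - 1 else int k)"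

lemma pt_nth [simp]: "pt j $ 1 = of_int j"
  by (simp add: pt_def)

lemma pt_eq_iff [simp]: "pt i = pt j \<longleftrightarrow> i = j"
  by (metis of_int_eq_iff pt_nth)

lemma norm_pt_diff: "norm (pt i - pt j) = of_int \<bar>i - j\<bar>"
proof -
  have "pt i - pt j = axis 1 (of_int (i - j))"
    by (simp add: pt_def axis_def vec_eq_iff)
  then show ?thesis by (simp add: norm_eq_sqrt_inner inner_axis_axis)
qed

lemma conf_0: "conf 0 = ({}, {})"
  by (simp add: conf_def)

lemma finite_conf [simp]: "finite (fst (conf k))" "finite (snd (conf k))"
  unfolding conf_def fst_conv snd_conv
  by (intro finite_imageI finite_Collect_conjI disjI1; simp)+

lemma red_blue_fresh: "pt (red k) \<notin> fst (conf k)" "pt (blue k) \<notin> snd (conf k)"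
  by (auto simp: conf_def red_def blue_def)

lemma conf_Suc: "conf (Suc k) = (insert (pt (red k)) (fst (conf k)), insert (pt (blue k)) (snd (conf k)))"
proof -
  have "{-int (Suc k)..<int (Suc k)} = insert (red k) (insert (blue k) {-int k..<int k})"
    by (auto simp: red_def blue_def)
  moreover have "even (red k)" "odd (blue k)"
    by (simp_all add: red_def blue_def)
  ultimately have "{j\<in>{-int (Suc k)..<int (Suc k)}. even j} = insert (red k) {j\<in>{-int k..<int k}. even j}"
    and "{j\<in>{-int (Suc k)..<int (Suc k)}. odd j} = insert (blue k) {j\<in>{-int k..<int k}. odd j}"
    by auto
  then show ?thesis
    unfolding conf_def by simp
qed

lemma card_conf: "card (fst (conf k)) = k" "card (snd (conf k)) = k"
  by (induction k) (simp_all add: conf_0 conf_Suc red_blue_fresh)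

text \<open>The leftmost integer \<open>- int k\<close> is red exactly when \<open>k\<close> is
  even, so a shift by one to the right (\<open>k\<close> even) or to the left (\<open>k\<close> odd)
  pairs all points. This bounds the optimum by \<open>k\<close>.\<close>

lemma matching_of_neighbours:
  defines "s k \<equiv> if even k then 1 else - 1 :: int"
  shows "\<exists>\<nu>. is_matching (conf k) \<nu> \<and> cost (conf k) \<nu> = k"
proof -
  define \<nu> where "\<nu> p = p + pt (s k)" for p
  have \<nu>: "\<nu> (pt j) = pt (j + s k)" for j
    by (simp add: \<nu>_def pt_def axis_def vec_eq_iff)
  have "(\<lambda>j. j + s k) ` {j\<in>{-int k..<int k}. even j} = {j\<in>{-int k..<int k}. odd j}" (is "?f ` ?A = ?B")
  proof (intro equalityI subsetI)
    fix j assume "j \<in> ?f ` ?A"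
    then obtain i where "j = i + s k" "- int k \<le> i" "i < int k" "even i"
      by auto
    \<comment> \<open>The one integer that the shift would push out of the interval is odd, hence
      not red.\<close>
    moreover from this have "i \<noteq> (if even k then int k - 1 else - int k)"
      by auto
    ultimately show "j \<in> ?B"
      by (auto simp: s_def split: if_splits)
  next
    fix j assume "j \<in> ?B"
    moreover from this have "j \<noteq> (if even k then - int k else int k - 1)"
      by auto
    ultimately have "j - s k \<in> ?A"
      by (auto simp: s_def split: if_splits)
    then show "j \<in> ?f ` ?A"
      by (metis (no_types, lifting) diff_add_cancel image_eqI)
  qed
  then have "pt ` ?f ` ?A = pt ` ?B"
    by (rule arg_cong)
  then have "\<nu> ` fst (conf k) = snd (conf k)"
    by (simp only: conf_def image_image \<nu> fst_conv snd_conv)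
  moreover have "inj_on \<nu> (fst (conf k))"
    by (simp add: \<nu>_def inj_on_def)
  ultimately have "is_matching (conf k) \<nu>"
    by (simp add: is_matching_def bij_betw_def)
  moreover have "norm (a - \<nu> a) = 1" if "a \<in> fst (conf k)" for a
    using that by (auto simp: conf_def \<nu> norm_pt_diff s_def)
  then have "cost (conf k) \<nu> = k"
    by (simp add: cost_def card_conf)
  ultimately show ?thesis by blast
qed

text \<open>The optimum is at most \<open>k\<close>. The second factor \<open>\<beta>\<close> is
  there because \<alpha> may be negative, and multiplying the bound on the optimum needs a
  nonnegative factor.\<close>

lemma cost_approx_le:
  assumes "is_approx_matching \<alpha> (conf k) \<mu>" and "\<alpha> \<le> \<beta>" and "0 \<le> \<beta>"
  shows "cost (conf k) \<mu> \<le> \<beta> * k"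
proof -
  obtain \<mu>' where min: "is_min_cost_matching (conf k) \<mu>'"
    and le: "cost (conf k) \<mu> \<le> \<alpha> * cost (conf k) \<mu>'"
    using assms(1) by (auto simp: is_approx_matching_def)
  have "0 \<le> cost (conf k) \<mu>'"
    by (simp add: cost_def sum_nonneg)
  then have "\<alpha> * cost (conf k) \<mu>' \<le> \<beta> * cost (conf k) \<mu>'"
    using assms(2) by (rule mult_right_mono[rotated])
  also have "\<dots> \<le> \<beta> * k"
    using min matching_of_neighbours[of k] assms(3)
    by (metis is_min_cost_matching_def mult_left_mono)
  finally show ?thesis using le by linarith
qed

section \<open>Parity of the number of edges across the gap between \<open>t\<close> and
  \<open>t + 1\<close>\<close>

definition crossing :: "int \<Rightarrow> (point \<times> point) set" where
  "crossing t = {(p, q). (p $ 1 \<le> of_int t) \<noteq> (q $ 1 \<le> of_int t)}"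

lemma finite_edges [simp]: "finite (edges (conf k) \<mu>)"
  by (simp add: edges_def)

lemma card_edges: "card (edges (conf k) \<mu>) = k"
  by (simp add: edges_def card_image inj_on_def card_conf)

text \<open>The symmetric difference of two finite sets has the sum of their sizes minus twice the
  size of the intersection.\<close>

lemma even_card_disagree:
  assumes "finite A"
  shows "even (card {x\<in>A. P x \<noteq> Q x}) \<longleftrightarrow> even (card {x\<in>A. P x} + card {x\<in>A. Q x})"
  using assms
proof induction
  case (insert x A)
  have "{y\<in>insert x A. R y} = (if R x then insert x {y\<in>A. R y} else {y\<in>A. R y})" for R
    by auto
  then show ?case using insert by auto
qed simp

text \<open>An edge crosses iff exactly one end is on the left, and every point is the end of
  exactly one edge. So the parity depends on the point sets alone, not on the matching.\<close>

lemma even_card_crossing: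
  assumes "is_matching (conf k) \<mu>"
  shows "even (card (edges (conf k) \<mu> \<inter> crossing t)) \<longleftrightarrow>
    even (card {p\<in>fst (conf k). p $ 1 \<le> of_int t} + card {p\<in>snd (conf k). p $ 1 \<le> of_int t})"
proof -
  let ?A = "fst (conf k)"
  have inj: "inj_on \<mu> ?A" and img: "\<mu> ` ?A = snd (conf k)"
    using assms by (auto simp: is_matching_def bij_betw_def)
  have "edges (conf k) \<mu> \<inter> crossing t =
      (\<lambda>a. (a, \<mu> a)) ` {a\<in>?A. (a $ 1 \<le> of_int t) \<noteq> (\<mu> a $ 1 \<le> of_int t)}"
    by (auto simp: edges_def crossing_def)
  then have "card (edges (conf k) \<mu> \<inter> crossing t) =
      card {a\<in>?A. (a $ 1 \<le> of_int t) \<noteq> (\<mu> a $ 1 \<le> of_int t)}"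
    by (simp add: card_image inj_on_def)
  moreover have "{p\<in>snd (conf k). p $ 1 \<le> of_int t} = \<mu> ` {a\<in>?A. \<mu> a $ 1 \<le> of_int t}"
    using img by auto
  then have "card {p\<in>snd (conf k). p $ 1 \<le> of_int t} = card {a\<in>?A. \<mu> a $ 1 \<le> of_int t}"
    using inj by (simp add: card_image inj_on_def)
  ultimately show ?thesis
    by (simp only: even_card_disagree[OF finite_conf(1)])
qed

text \<open>Of the two new points, at \<open>- int k - 1\<close> and \<open>k\<close>, exactly one
  lies to the left of the gap.\<close>

lemma parity_flip:
  assumes "is_matching (conf k) \<mu>" and "is_matching (conf (Suc k)) \<mu>'"
    and "t \<in> {-int k..<int k}"
  shows "even (card (edges (conf k) \<mu> \<inter> crossing t)) \<noteq>
    even (card (edges (conf (Suc k)) \<mu>' \<inter> crossing t))"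
proof -
  have *: "card {p\<in>insert x S. R p} = (if R x then 1 else 0) + card {p\<in>S. R p}"
    if "finite S" "x \<notin> S" for x :: point and S R
  proof -
    have "{p\<in>insert x S. R p} = (if R x then insert x {p\<in>S. R p} else {p\<in>S. R p})"
      by auto
    then show ?thesis using that by simp
  qed
  have "red k \<le> t \<longleftrightarrow> \<not> blue k \<le> t"
    using assms(3) by (auto simp: red_def blue_def)
  then show ?thesis
    unfolding even_card_crossing[OF assms(1)] even_card_crossing[OF assms(2)]
    unfolding conf_Suc fst_conv snd_conv
      *[OF finite_conf(1) red_blue_fresh(1)] *[OF finite_conf(2) red_blue_fresh(2)]
    by auto
qed

section \<open>Lower bounds on cost from crossings\<close>

lemma sum_card_crossing_le_cost:
  assumes "is_matching (conf k) \<mu>" and "finite T"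
  shows "real (\<Sum>t\<in>T. card (edges (conf k) \<mu> \<inter> crossing t)) \<le> cost (conf k) \<mu>"
proof -
  let ?E = "edges (conf k) \<mu>"
  have *: "card (?E \<inter> X) = (\<Sum>e\<in>?E. if e \<in> X then 1 else 0)" for X
    by (simp add: sum.If_cases Int_def)
  \<comment> \<open>Double counting: instead of edges per gap, count gaps per edge; an edge crosses
    no more gaps than its length.\<close>
  have "(\<Sum>t\<in>T. card (?E \<inter> crossing t)) = (\<Sum>e\<in>?E. \<Sum>t\<in>T. if e \<in> crossing t then 1 else 0)"
    unfolding * by (rule sum.swap)
  also have "\<dots> = (\<Sum>e\<in>?E. card {t\<in>T. e \<in> crossing t})"
    using assms(2) by (simp add: sum.If_cases Int_def)
  also have "\<dots> = (\<Sum>a\<in>fst (conf k). card {t\<in>T. (a, \<mu> a) \<in> crossing t})"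
    unfolding edges_def by (subst sum.reindex) (auto simp: inj_on_def)
  also have "real \<dots> \<le> cost (conf k) \<mu>"
    unfolding cost_def of_nat_sum
  proof (rule sum_mono)
    fix a assume a: "a \<in> fst (conf k)"
    then have "\<mu> a \<in> snd (conf k)"
      using assms(1) by (auto simp: is_matching_def bij_betw_def)
    then obtain i j where ij: "a = pt i" "\<mu> a = pt j"
      using a by (auto simp: conf_def)
    have "{t\<in>T. (a, \<mu> a) \<in> crossing t} \<subseteq> {min i j..<max i j}"
      unfolding ij(2) unfolding ij(1) by (auto simp: crossing_def)
    then have "card {t\<in>T. (a, \<mu> a) \<in> crossing t} \<le> card {min i j..<max i j}"
      by (intro card_mono) auto
    also have "\<dots> = nat \<bar>i - j\<bar>"
      by simp
    finally show "real (card {t\<in>T. (a, \<mu> a) \<in> crossing t}) \<le> norm (a - \<mu> a)"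
      unfolding ij(2) unfolding ij(1) norm_pt_diff by linarith
  qed
  finally show ?thesis .
qed

text \<open>The ends of an edge have different parities, so they are distinct, and the gap just
  right of the left end is crossed.\<close>

lemma edge_crosses_gap:
  assumes "is_matching (conf k) \<mu>" and "e \<in> edges (conf k) \<mu>"
  shows "\<exists>t\<in>{-int k..<int k - 1}. e \<in> crossing t"
proof -
  obtain a where a: "a \<in> fst (conf k)" "e = (a, \<mu> a)"
    using assms(2) by (auto simp: edges_def)
  then have "\<mu> a \<in> snd (conf k)"
    using assms(1) by (auto simp: is_matching_def bij_betw_def)
  then obtain i j where ij: "a = pt i" "even i" "i \<in> {-int k..<int k}"
    "\<mu> a = pt j" "odd j" "j \<in> {-int k..<int k}"
    using a by (auto simp: conf_def)
  then have "i \<noteq> j" by auto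
  then have "min i j \<in> {-int k..<int k - 1} \<and> e \<in> crossing (min i j)"
    using ij by (auto simp: a crossing_def min_def)
  then show ?thesis by blast
qed

lemma costs_ge_common_edges:
  assumes \<mu>: "is_matching (conf k) \<mu>" and \<mu>': "is_matching (conf (Suc k)) \<mu>'"
  defines "S \<equiv> edges (conf k) \<mu> \<inter> edges (conf (Suc k)) \<mu>'"
  shows "2 * real (card S) + 2 * real k - 1 \<le> cost (conf k) \<mu> + cost (conf (Suc k)) \<mu>'"
proof -
  \<comment> \<open>Only gaps inside the smaller interval: those next to the two new points are left
    out.\<close>
  let ?T = "{-int k..<int k - 1}"
  let ?E = "edges (conf k) \<mu>" and ?E' = "edges (conf (Suc k)) \<mu>'"
  have "finite S" by (simp add: S_def)
  \<comment> \<open>Each surviving edge is counted in at least one gap, so the sum over all gaps is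
    at least \<open>card S\<close>.\<close>
  have "S \<subseteq> (\<Union>t\<in>?T. S \<inter> crossing t)"
    using edge_crosses_gap[OF \<mu>] by (auto simp: S_def)
  then have "card S \<le> card (\<Union>t\<in>?T. S \<inter> crossing t)"
    using \<open>finite S\<close> by (intro card_mono) auto
  also have "\<dots> \<le> (\<Sum>t\<in>?T. card (S \<inter> crossing t))"
    by (rule card_UN_le) simp
  finally have "2 * card S + card ?T \<le> (\<Sum>t\<in>?T. 2 * card (S \<inter> crossing t) + 1)"
    unfolding sum.distrib sum_distrib_left[symmetric] by simp
  also have "\<dots> \<le> (\<Sum>t\<in>?T. card (?E \<inter> crossing t) + card (?E' \<inter> crossing t))"
  proof (rule sum_mono)
    fix t assume "t \<in> ?T"
    \<comment> \<open>Both counts are at least the common one; different parities forbid equality,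
      which gains the extra 1.\<close>
    then have ne: "card (?E \<inter> crossing t) \<noteq> card (?E' \<inter> crossing t)"
      using parity_flip[OF \<mu> \<mu>', of t] by auto
    have "card (S \<inter> crossing t) \<le> card (?E \<inter> crossing t)"
      by (intro card_mono) (auto simp: S_def)
    moreover have "card (S \<inter> crossing t) \<le> card (?E' \<inter> crossing t)"
      by (intro card_mono) (auto simp: S_def)
    ultimately show "2 * card (S \<inter> crossing t) + 1 \<le> card (?E \<inter> crossing t) + card (?E' \<inter> crossing t)"
      using ne by linarith
  qed
  finally have "real (2 * card S + card ?T) \<le>
      real (\<Sum>t\<in>?T. card (?E \<inter> crossing t)) + real (\<Sum>t\<in>?T. card (?E' \<inter> crossing t))"
    unfolding sum.distrib by linarith
  also have "\<dots> \<le> cost (conf k) \<mu> + cost (conf (Suc k)) \<mu>'"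
    by (intro add_mono sum_card_crossing_le_cost \<mu> \<mu>') simp_all
  finally show ?thesis by simp
qed

text \<open>The symmetric difference has \<open>2 * k + 1\<close> minus twice the number of common
  edges, while the two costs add up to at most
  \<open>(2 - \<epsilon>) * (2 * k + 1)\<close>.\<close>

lemma card_changed_edges:
  assumes \<mu>: "is_approx_matching (2 - \<delta>) (conf k) \<mu>"
    and \<mu>': "is_approx_matching (2 - \<delta>) (conf (Suc k)) \<mu>'"
    and \<epsilon>: "\<epsilon> \<le> \<delta>" "\<epsilon> \<le> 1"
  defines "M \<equiv> edges (conf k) \<mu>" and "M' \<equiv> edges (conf (Suc k)) \<mu>'"
  shows "\<epsilon> * (2 * real k + 1) - 2 \<le> real (card ((M - M') \<union> (M' - M)))"
proof -
  have fin: "finite M" "finite M'"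
    by (simp_all add: M_def M'_def)
  have "card ((M - M') \<union> (M' - M)) = card (M - M') + card (M' - M)"
    using fin by (intro card_Un_disjoint) auto
  moreover have "card (M - M') + card (M \<inter> M') = k"
    using card_Int_Diff[OF fin(1), of M'] by (simp add: M_def card_edges)
  moreover have "card (M' - M) + card (M \<inter> M') = Suc k"
    using card_Int_Diff[OF fin(2), of M] by (simp add: M'_def card_edges Int_commute)
  ultimately have "real (card ((M - M') \<union> (M' - M))) = 2 * real k + 1 - 2 * real (card (M \<inter> M'))"
    by linarith
  moreover have "2 * real (card (M \<inter> M')) + 2 * real k - 1 \<le> cost (conf k) \<mu> + cost (conf (Suc k)) \<mu>'"
    using \<mu> \<mu>' unfolding M_def M'_def is_approx_matching_def
    by (intro costs_ge_common_edges) auto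
  moreover have "cost (conf k) \<mu> \<le> (2 - \<epsilon>) * real k"
    using cost_approx_le[OF \<mu>] \<epsilon> by simp
  moreover have "cost (conf (Suc k)) \<mu>' \<le> (2 - \<epsilon>) * real (Suc k)"
    using cost_approx_le[OF \<mu>'] \<epsilon> by simp
  ultimately show ?thesis
    by (simp add: algebra_simps)
qed

section \<open>Summing the changes over a run\<close>

lemma sum_odd_real: "(\<Sum>i<N. 2 * real i + 1) = real N * real N"
  by (induction N) (simp_all add: algebra_simps)

text \<open>Serves growing and shrinking runs alike: \<open>m i\<close> is the smaller of the two
  stages joined by update \<open>i\<close>, and the unordered pair hides the direction.\<close>

lemma total_time_ge:
  assumes alg: "dynamic_matching_algorithm R (2 - \<delta>) alg"
    and \<epsilon>: "\<epsilon> \<le> \<delta>" "\<epsilon> \<le> 1"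
    and N: "length us = N"
    and run: "\<And>i. i \<le> N \<Longrightarrow> (C, take i us) \<in> R"
    and step: "\<And>i. i < N \<Longrightarrow> {apply_updates C (take i us), apply_updates C (take (Suc i) us)} =
      {conf (m i), conf (Suc (m i))}"
    and m: "bij_betw m {..<N} {..<N}"
  shows "\<epsilon> * (real N * real N) - 2 * real N \<le> total_time alg C us"
proof -
  have "\<epsilon> * (2 * real (m i) + 1) - 2 \<le> upd_time alg C (take (Suc i) us)" if i: "i < N" for i
  proof -
    have snoc: "take (Suc i) us = take i us @ [us ! i]"
      using i N by (simp add: take_Suc_conv_app_nth)
    have approx: "is_approx_matching (2 - \<delta>) (apply_updates C (take j us)) (alg_matching alg C (take j us))"
      if "j \<le> N" for j
      using alg run[OF that] by (auto simp: dynamic_matching_algorithm_def maintains_approx_def)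
    have "conf (m i) \<noteq> conf (Suc (m i))"
      by (metis card_conf(1) n_not_Suc_n)
    then consider
        "apply_updates C (take i us) = conf (m i)" "apply_updates C (take (Suc i) us) = conf (Suc (m i))"
      | "apply_updates C (take i us) = conf (Suc (m i))" "apply_updates C (take (Suc i) us) = conf (m i)"
      using step[OF i] by (auto simp: doubleton_eq_iff)
    then have "\<epsilon> * (2 * real (m i) + 1) - 2 \<le> real (num_changes alg C (take i us) (us ! i))"
    proof cases
      case 1
      then show ?thesis
        using card_changed_edges[of \<delta> "m i" "alg_matching alg C (take i us)"
            "alg_matching alg C (take (Suc i) us)" \<epsilon>] approx[of i] approx[of "Suc i"] i \<epsilon>
        by (simp add: num_changes_def Let_def snoc)
    next
      case 2
      then show ?thesis
        using card_changed_edges[of \<delta> "m i" "alg_matching alg C (take (Suc i) us)"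
            "alg_matching alg C (take i us)" \<epsilon>] approx[of i] approx[of "Suc i"] i \<epsilon>
        by (simp add: num_changes_def Let_def snoc Un_commute)
    qed
    also have "\<dots> \<le> upd_time alg C (take (Suc i) us)"
      using alg run[OF Suc_leI[OF i]]
      unfolding dynamic_matching_algorithm_def explicit_updates_def snoc by blast
    finally show ?thesis .
  qed
  then have "(\<Sum>i<N. \<epsilon> * (2 * real (m i) + 1) - 2) \<le> total_time alg C us"
    unfolding total_time_def N by (intro sum_mono) auto
  \<comment> \<open>Every stage below \<open>N\<close> is the smaller one exactly once, so the order
    of the updates does not affect the sum.\<close>
  moreover have "(\<Sum>i<N. \<epsilon> * (2 * real (m i) + 1) - 2) = (\<Sum>i<N. \<epsilon> * (2 * real i + 1) - 2)"
    using m by (rule sum.reindex_bij_betw)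
  moreover have "\<dots> = \<epsilon> * (real N * real N) - 2 * real N"
    by (simp add: sum_subtractf sum_distrib_left[symmetric] sum_odd_real)
  ultimately show ?thesis by simp
qed

text \<open>There are \<open>N\<close> updates for \<open>2 * N\<close> points;
  \<open>4 \<le> \<epsilon> * N\<close> lets half of \<open>\<epsilon> * N\<close> absorb the loss
  of 2 per update.\<close>

lemma amortized_ge:
  assumes "\<epsilon> * (real N * real N) - 2 * real N \<le> total_time alg C us"
    and "(C, us) \<in> R" and "length us = N" and "0 < N" and "4 \<le> \<epsilon> * real N"
  shows "ereal (\<epsilon> / 4 * real (2 * N)) \<le> amortized_update_time R alg"
proof -
  have "\<epsilon> / 4 * real (2 * N) \<le> \<epsilon> * real N - 2"
    using assms(5) by simp
  also have "\<dots> \<le> total_time alg C us / real (length us)"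
    using assms(1,3,4) by (simp add: field_simps)
  finally have "ereal (\<epsilon> / 4 * real (2 * N)) \<le> ereal (total_time alg C us / real (length us))"
    by simp
  also have "\<dots> \<le> amortized_update_time R alg"
    unfolding amortized_update_time_def using assms(2) by (rule SUP_upper2) simp
  finally show ?thesis .
qed

section \<open>The insertion and deletion runs\<close>

lemma apply_updates_simps [simp]:
  "apply_updates C [] = C"
  "apply_updates C (us @ [u]) = apply_update (apply_updates C us) u"
  by (simp_all add: apply_updates_def)

lemma legal_updates_snoc [simp]:
  "legal_updates C (us @ [u]) \<longleftrightarrow> legal_updates C us \<and> legal_update (apply_updates C us) u"
  by (induction us arbitrary: C) (simp_all add: apply_updates_def)

definition inserts :: "nat \<Rightarrow> update list" where
  "inserts i = map (\<lambda>j. Insert (pt (red j)) (pt (blue j))) [0..<i]"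

lemma inserts_run:
  "legal_updates ({}, {}) (inserts i) \<and> apply_updates ({}, {}) (inserts i) = conf i"
proof (induction i)
  case (Suc i)
  then show ?case
    using red_blue_fresh[of i] by (cases "conf i") (simp add: inserts_def conf_Suc)
qed (simp add: inserts_def conf_0)

text \<open>Undoes \<open>inserts N\<close> from the last pair backwards.\<close>

definition deletes :: "nat \<Rightarrow> nat \<Rightarrow> update list" where
  "deletes N i = map (\<lambda>j. Delete (pt (red (N - Suc j))) (pt (blue (N - Suc j)))) [0..<i]"

lemma deletes_run:
  "i \<le> N \<Longrightarrow> legal_updates (conf N) (deletes N i) \<and>
    apply_updates (conf N) (deletes N i) = conf (N - i)"
proof (induction i)
  case (Suc i)
  \<comment> \<open>As \<open>i < N\<close>, the truncated subtraction is exact, and the pair to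
    delete is the one added last.\<close>
  then have "N - i = Suc (N - Suc i)" by simp
  then have "conf (N - i) = (insert (pt (red (N - Suc i))) (fst (conf (N - Suc i))),
      insert (pt (blue (N - Suc i))) (snd (conf (N - Suc i))))"
    by (simp only: conf_Suc)
  then show ?case
    using Suc red_blue_fresh[of "N - Suc i"] by (simp add: deletes_def)
qed (simp add: deletes_def)

lemma insertion_lower_bound:
  assumes alg: "dynamic_matching_algorithm insertion_runs (2 - \<delta>) alg"
    and \<epsilon>: "\<epsilon> \<le> \<delta>" "\<epsilon> \<le> 1" and N: "0 < N" "4 \<le> \<epsilon> * real N"
  shows "ereal (\<epsilon> / 4 * real (2 * N)) \<le> amortized_update_time (complete_insertion_runs (2 * N)) alg"
proof (rule amortized_ge)
  have take: "take i (inserts N) = inserts i" if "i \<le> N" for i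
    using that by (simp add: inserts_def take_map)
  have run: "(({}, {}), inserts i) \<in> insertion_runs" for i
    using inserts_run[of i] by (auto simp: insertion_runs_def inserts_def)
  show "\<epsilon> * (real N * real N) - 2 * real N \<le> total_time alg ({}, {}) (inserts N)"
  proof (rule total_time_ge[OF alg \<epsilon>])
    show "length (inserts N) = N" by (simp add: inserts_def)
    show "bij_betw (\<lambda>i. i) {..<N} {..<N}" by (simp add: bij_betw_def)
  qed (simp_all add: take run inserts_run)
  show "(({}, {}), inserts N) \<in> complete_insertion_runs (2 * N)"
    using run by (simp add: complete_insertion_runs_def inserts_run num_points_def card_conf)
  show "length (inserts N) = N" by (simp add: inserts_def)
qed (use N in auto)

lemma deletion_lower_bound:
  assumes alg: "dynamic_matching_algorithm deletion_runs (2 - \<delta>) alg"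
    and \<epsilon>: "\<epsilon> \<le> \<delta>" "\<epsilon> \<le> 1" and N: "0 < N" "4 \<le> \<epsilon> * real N"
  shows "ereal (\<epsilon> / 4 * real (2 * N)) \<le> amortized_update_time (complete_deletion_runs (2 * N)) alg"
proof (rule amortized_ge)
  have take: "take i (deletes N N) = deletes N i" if "i \<le> N" for i
    using that by (simp add: deletes_def take_map)
  have run: "(conf N, deletes N i) \<in> deletion_runs" if "i \<le> N" for i
    using deletes_run[OF that] by (auto simp: deletion_runs_def deletes_def card_conf)
  show "\<epsilon> * (real N * real N) - 2 * real N \<le> total_time alg (conf N) (deletes N N)"
  proof (rule total_time_ge[OF alg \<epsilon>])
    show "length (deletes N N) = N" by (simp add: deletes_def)
    \<comment> \<open>Deletion \<open>i\<close> leads from stage \<open>N - i\<close> down to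
      \<open>N - Suc i\<close>, so the stages are met in reverse.\<close>
    show "bij_betw (\<lambda>i. N - Suc i) {..<N} {..<N}"
      by (rule bij_betwI[where g = "\<lambda>i. N - Suc i"]) auto
    show "{apply_updates (conf N) (take i (deletes N N)),
        apply_updates (conf N) (take (Suc i) (deletes N N))} =
      {conf (N - Suc i), conf (Suc (N - Suc i))}" if "i < N" for i
      using that by (simp add: take deletes_run Suc_diff_Suc insert_commute)
  qed (simp_all add: take run)
  show "(conf N, deletes N N) \<in> complete_deletion_runs (2 * N)"
    using run deletes_run[of N N]
    by (simp add: complete_deletion_runs_def num_points_def card_conf conf_0)
  show "length (deletes N N) = N" by (simp add: deletes_def)
qed (use N in auto)

theorem theorem6:
  fixes \<delta> :: real
  assumes "\<delta> > 0"
  shows "(\<exists>c>0. \<exists>n\<^sub>0. \<forall>alg. dynamic_matching_algorithm insertion_runs (2 - \<delta>) alg \<longrightarrow>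
            (\<forall>n\<ge>n\<^sub>0. even n \<longrightarrow>
               ereal (c * real n) \<le> amortized_update_time (complete_insertion_runs n) alg)) \<and>
         (\<exists>c>0. \<exists>n\<^sub>0. \<forall>alg. dynamic_matching_algorithm deletion_runs (2 - \<delta>) alg \<longrightarrow>
            (\<forall>n\<ge>n\<^sub>0. even n \<longrightarrow>
               ereal (c * real n) \<le> amortized_update_time (complete_deletion_runs n) alg))"
proof -
  \<comment> \<open>Capping at 1 keeps \<open>2 - \<epsilon>\<close> positive even for large
    \<delta>.\<close>
  define \<epsilon> where "\<epsilon> = min \<delta> 1"
  have \<epsilon>: "0 < \<epsilon>" "\<epsilon> \<le> \<delta>" "\<epsilon> \<le> 1"
    using assms by (auto simp: \<epsilon>_def)
  \<comment> \<open>With \<open>n = 2 * N\<close>, the bound \<open>8 / \<epsilon> \<le> n\<close>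
    is the required \<open>4 \<le> \<epsilon> * N\<close>.\<close>
  define n\<^sub>0 where "n\<^sub>0 = nat \<lceil>8 / \<epsilon>\<rceil>"
  have large: "0 < N \<and> 4 \<le> \<epsilon> * real N" if "n\<^sub>0 \<le> 2 * N" for N
  proof -
    have "8 / \<epsilon> \<le> real (2 * N)"
      using that by (simp add: n\<^sub>0_def)
    then have "4 \<le> \<epsilon> * real N"
      using \<epsilon>(1) by (simp add: field_simps)
    then show ?thesis by (cases N) auto
  qed
  have "\<forall>alg. dynamic_matching_algorithm insertion_runs (2 - \<delta>) alg \<longrightarrow>
      (\<forall>n\<ge>n\<^sub>0. even n \<longrightarrow>
         ereal (\<epsilon> / 4 * real n) \<le> amortized_update_time (complete_insertion_runs n) alg)"
    using insertion_lower_bound[OF _ \<epsilon>(2,3)] large by (blast elim: evenE)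
  moreover have "\<forall>alg. dynamic_matching_algorithm deletion_runs (2 - \<delta>) alg \<longrightarrow>
      (\<forall>n\<ge>n\<^sub>0. even n \<longrightarrow>
         ereal (\<epsilon> / 4 * real n) \<le> amortized_update_time (complete_deletion_runs n) alg)"
    using deletion_lower_bound[OF _ \<epsilon>(2,3)] large by (blast elim: evenE)
  moreover have "0 < \<epsilon> / 4"
    using \<epsilon>(1) by simp
  ultimately show ?thesis by blast
qed

end
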